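(* Let $(\mathcal A,\varphi)$ be a noncommutative probability space. There exists a unique family of multilinear functionals $\bigl(\kappa_\chi:\mathcal A^n\to\mathbb C\bigr)_{n\ge1,\ \chi\in\{\ell,r\}^n}$ such that $$\varphi(a_1\cdots a_n)=\sum_{\pi\in\mathcal P^{(\chi)}(n)}\ \Bigl(\prod_{V\in\pi}\kappa_{\chi\mid V}\bigl((a_1,\dots,a_n)\mid V\bigr)\Bigr)$$ for every $n\ge1$, every $\chi\in\{\ell,r\}^n$ and all $a_1,\dots,a_n\in\mathcal A$.
   Context: A noncommutative probability space is a unital algebra $\mathcal A$ over $\mathbb C$ with a linear functional $\varphi:\mathcal A\to\mathbb C$, $\varphi(1)=1$. For a tuple $(x_1,\dots,x_n)$ and $V=\{i_1<\cdots<i_m\}\subseteq\{1,\dots,n\}$, put $(x_1,\dots,x_n)\mid V:=(x_{i_1},\dots,x_{i_m})$; this is used for tuples in $\mathcal A^n$ and for $\chi\in\{\ell,r\}^n$. **Lukasiewicz paths.** $\mathrm{Luk}(n)$ is the set of lattice paths $\lambda=((0,0),(1,j_1),\dots,(n,j_n))$ with all steps of the form $(1,i)$, $i\in\{-1,0,1,2,\dots\}$, with $j_m\ge0$ for all $m$ and $j_n=0$. The rise-vector of $\lambda$ is $(j_1,j_2-j_1,\dots,j_n-j_{n-1})$; it determines $\lambda$. **Output-time partitions.** Let $\lambda\in\mathrm{Luk}(n)$ have rise-vector $(p_1-1,\dots,p_n-1)$ with $p_i\in\{0,1,2,\dots\}$, and let $\chi=(h_1,\dots,h_n)\in\{\ell,r\}^n$.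 Consider $n$ balls labelled $1,\dots,n$ and a horizontal row (the deque), initially empty. For $i=1,\dots,n$ the $i$-th move is: insert the $p_i$ balls with labels $p_1+\cdots+p_{i-1}+1,\dots,p_1+\cdots+p_i$ one at a time, in increasing order of labels, at the left end of the deque if $h_i=\ell$, at the right end if $h_i=r$; then remove from the deque its leftmost ball if $h_i=\ell$, its rightmost ball if $h_i=r$; the removed ball has output time $i$. For each $i$ with $p_i>0$ let $T_i$ be the set of output times of the $p_i$ balls inserted in the $i$-th move. The output-time partition associated to $(\lambda,\chi)$ is $\Phi_\chi(\lambda):=\{T_i: 1\le i\le n,\ p_i>0\}$, a partition of $\{1,\dots,n\}$. Define $\mathcal P^{(\chi)}(n):=\{\Phi_\chi(\lambda):\lambda\in\mathrm{Luk}(n)\}$. *)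

theory Defs
  imports Complex_Main "HOL-Library.FuncSet" "HOL-Library.Product_Plus"
begin

section \<open>Noncommutative probability spaces and multilinear functionals\<close>

text \<open>The class \<open>ring_1\<close> excludes the zero ring; this loses no generality, since
  \<open>\<phi> 1 = 1\<close> and linearity force \<open>1 \<noteq> 0\<close>.\<close>

locale nc_prob_space = Vector_Spaces.linear scale "(*)" \<phi>
  for scale :: "complex \<Rightarrow> 'a::ring_1 \<Rightarrow> 'a" and \<phi> :: "'a \<Rightarrow> complex" +
  assumes scale_mult_left: "scale c x * y = scale c (x * y)"
    and scale_mult_right: "x * scale c y = scale c (x * y)"
    and unital: "\<phi> 1 = 1"

text \<open>Elements of \<open>A\<^sup>n\<close> are lists of length \<open>n\<close>. The functionals are made extensional
  so that equality of functions on all lists is equality on \<open>A\<^sup>n\<close>.\<close>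

definition multilinear_functionals ::
    "(complex \<Rightarrow> 'a::ring_1 \<Rightarrow> 'a) \<Rightarrow> nat \<Rightarrow> ('a list \<Rightarrow> complex) set" where
  "multilinear_functionals scale n =
     {f \<in> extensional {xs. length xs = n}.
        \<forall>xs i. length xs = n \<longrightarrow> i < n \<longrightarrow>
          Vector_Spaces.linear scale (*) (\<lambda>x. f (xs[i := x]))}"

text \<open>Positions are counted from 1 in \<open>V\<close>, but from 0 in lists.\<close>

definition subtuple :: "'b list \<Rightarrow> nat set \<Rightarrow> 'b list" where
  "subtuple xs V = nths xs {i. Suc i \<in> V}"

section \<open>Lukasiewicz paths\<close>

definition Luk :: "nat \<Rightarrow> (int \<times> int) list set" where
  "Luk n = {path. length path = Suc n \<and> path ! 0 = (0, 0) \<and>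
              (\<forall>m<n. path ! Suc m - path ! m \<in> {1} \<times> {-1..}) \<and>
              (\<forall>m\<le>n. snd (path ! m) \<ge> 0) \<and> snd (path ! n) = 0}"

definition rise_vector :: "(int \<times> int) list \<Rightarrow> int list" where
  "rise_vector path =
     map (\<lambda>m. snd (path ! Suc m) - snd (path ! m)) [0..<length path - 1]"

section \<open>Output-time partitions\<close>

datatype side = Lft | Rgt

text \<open>A deque is the list of the labels it contains, read from left to right.\<close>

fun push :: "side \<Rightarrow> nat \<Rightarrow> nat list \<Rightarrow> nat list" where
  "push Lft b d = b # d"
| "push Rgt b d = d @ [b]"

fun peek :: "side \<Rightarrow> nat list \<Rightarrow> nat" where
  "peek Lft d = hd d"
| "peek Rgt d = last d"

fun pop :: "side \<Rightarrow> nat list \<Rightarrow> nat list" where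
  "pop Lft d = tl d"
| "pop Rgt d = butlast d"

text \<open>Below, \<open>p\<close> is the list \<open>(p\<^sub>1, \<dots>, p\<^sub>n)\<close>, and the argument \<open>i\<close> refers to the move
  number \<open>i + 1\<close>, which uses \<open>p ! i\<close> and \<open>\<chi> ! i\<close>. Labels and output times are counted
  from 1.\<close>

definition batch :: "nat list \<Rightarrow> nat \<Rightarrow> nat list" where
  "batch p i = [sum_list (take i p) + 1 ..< sum_list (take i p) + p ! i + 1]"

definition insert_batch :: "side list \<Rightarrow> nat list \<Rightarrow> nat \<Rightarrow> nat list \<Rightarrow> nat list" where
  "insert_batch \<chi> p i d = fold (push (\<chi> ! i)) (batch p i) d"

text \<open>The deque after \<open>k\<close> moves.\<close>

primrec deque :: "side list \<Rightarrow> nat list \<Rightarrow> nat \<Rightarrow> nat list" where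
  "deque \<chi> p 0 = []"
| "deque \<chi> p (Suc k) = pop (\<chi> ! k) (insert_batch \<chi> p k (deque \<chi> p k))"

definition removed_ball :: "side list \<Rightarrow> nat list \<Rightarrow> nat \<Rightarrow> nat" where
  "removed_ball \<chi> p i = peek (\<chi> ! i) (insert_batch \<chi> p i (deque \<chi> p i))"

definition output_times :: "side list \<Rightarrow> nat list \<Rightarrow> nat \<Rightarrow> nat set" where
  "output_times \<chi> p i = {Suc t | t. t < length p \<and> removed_ball \<chi> p t \<in> set (batch p i)}"

definition output_time_partition :: "side list \<Rightarrow> (int \<times> int) list \<Rightarrow> nat set set" where
  "output_time_partition \<chi> path =
     (let p = map (\<lambda>r. nat (r + 1)) (rise_vector path)
      in {output_times \<chi> p i | i. i < length p \<and> p ! i > 0})"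

definition output_time_partitions :: "side list \<Rightarrow> nat set set set" where
  "output_time_partitions \<chi> = output_time_partition \<chi> ` Luk (length \<chi>)"

end

theory Submission imports Defs "HOL-Library.Disjoint_Sets" begin

text \<open>Every output-time partition is a partition of \<open>{1..n}\<close> into nonempty blocks, because the
  Lukasiewicz condition keeps the deque nonempty before each removal, and the one-block partition
  occurs, for the path with rise-vector \<open>(n - 1, -1, \<dots>, -1)\<close>. The formula therefore reads
  \<open>\<phi>(a\<^sub>1 \<cdots> a\<^sub>n) = \<kappa>\<^sub>\<chi>(a\<^sub>1, \<dots>, a\<^sub>n) +\<close> terms that involve only functionals of fewer arguments,
  which determines \<open>\<kappa>\<close> recursively. Each position lies in exactly one block, so these terms are
  multilinear.\<close>

section \<open>Output-time partitions\<close>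

text \<open>The list \<open>p\<close> is (p_1, ..., p_n). The path has height
  \<open>sum_list (take k p) - k\<close> after k steps, so the two conditions express nonnegative
  heights and final height 0. This height is also the number of balls left in the deque.\<close>

locale luk_word =
  fixes p :: "nat list"
  assumes le_sum_take: "k \<le> length p \<Longrightarrow> k \<le> sum_list (take k p)"
    and sum_eq_length: "sum_list p = length p"

section \<open>Elementary deque operations\<close>

lemma fold_push_Lft: "fold (push Lft) bs d = rev bs @ d"
  by (induction bs arbitrary: d) auto

lemma fold_push_Rgt: "fold (push Rgt) bs d = d @ bs"
  by (induction bs arbitrary: d) auto

lemma set_fold_push: "set (fold (push h) bs d) = set bs \<union> set d"
  by (cases h) (auto simp: fold_push_Lft fold_push_Rgt)

lemma distinct_fold_push:
  "distinct (fold (push h) bs d) \<longleftrightarrow> distinct bs \<and> distinct d \<and> set bs \<inter> set d = {}"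
  by (cases h) (auto simp: fold_push_Lft fold_push_Rgt)

lemma peek_in_set: "d \<noteq> [] \<Longrightarrow> peek h d \<in> set d"
  by (cases h) auto

lemma distinct_pop: "distinct d \<Longrightarrow> distinct (pop h d)"
  by (cases h) (auto simp: distinct_tl distinct_butlast)

text \<open>Distinctness guarantees that the label at the end does not occur a second time inside
  the deque.\<close>

lemma set_pop:
  assumes "distinct d" "d \<noteq> []"
  shows "set (pop h d) = set d - {peek h d}"
proof (cases h)
  case Lft
  then show ?thesis using assms by (cases d) auto
next
  case Rgt
  then show ?thesis using assms by (cases d rule: rev_cases) auto
qed

lemma set_batch:
  "k < length p \<Longrightarrow> set (batch p k) = {sum_list (take k p)<..sum_list (take (Suc k) p)}"
  by (auto simp: batch_def take_Suc_conv_app_nth)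

section \<open>The deque process driven by a Lukasiewicz word\<close>

context luk_word
begin

text \<open>Induction on the moves: each new batch consists of fresh labels, and a removal only
  transfers one label from the deque to the set of removed balls. The Lukasiewicz condition enters
  to make that removal possible.\<close>

lemma deque_invariant:
  assumes "k \<le> length p"
  shows "distinct (deque \<chi> p k) \<and>
    set (deque \<chi> p k) \<union> removed_ball \<chi> p ` {..<k} = {1..sum_list (take k p)} \<and>
    set (deque \<chi> p k) \<inter> removed_ball \<chi> p ` {..<k} = {} \<and>
    inj_on (removed_ball \<chi> p) {..<k}"
  using assms
proof (induction k)
  case 0
  then show ?case by simp
next
  case (Suc k)
  define S where "S = sum_list (take k p)"
  define S' where "S' = sum_list (take (Suc k) p)"
  define R where "R = removed_ball \<chi> p ` {..<k}"
  define D where "D = insert_batch \<chi> p k (deque \<chi> p k)"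
  define b where "b = removed_ball \<chi> p k"
  have IH: "distinct (deque \<chi> p k)" "set (deque \<chi> p k) \<union> R = {1..S}"
      "set (deque \<chi> p k) \<inter> R = {}" "inj_on (removed_ball \<chi> p) {..<k}"
    using Suc unfolding R_def S_def by auto
  have B: "set (batch p k) = {S<..S'}"
    using Suc.prems by (simp add: set_batch S_def S'_def)
  have "S \<le> S'"
    using Suc.prems by (simp add: S_def S'_def take_Suc_conv_app_nth)
  \<comment> \<open>The new labels \<open>{S<..S'}\<close> lie directly above the labels
    \<open>{1..S}\<close> used so far.\<close>
  have D_Un: "set D \<union> R = {1..S'}"
  proof -
    have "set D \<union> R = {S<..S'} \<union> (set (deque \<chi> p k) \<union> R)"
      by (auto simp: D_def insert_batch_def set_fold_push B)
    also have "\<dots> = {1..S'}"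
      using IH(2) \<open>S \<le> S'\<close> by auto
    finally show ?thesis .
  qed
  have "R \<subseteq> {1..S}" "set (deque \<chi> p k) \<subseteq> {1..S}" using IH(2) by auto
  then have "R \<inter> {S<..S'} = {}" "set (deque \<chi> p k) \<inter> {S<..S'} = {}"
    by fastforce+
  then have D_Int: "set D \<inter> R = {}" and D_distinct: "distinct D"
    using IH(1,3) by (auto simp: D_def insert_batch_def set_fold_push distinct_fold_push B)
      (auto simp: batch_def)
  \<comment> \<open>If the deque were empty, all \<open>S'\<close> labels inserted so far would have
    been removed in the first \<open>k\<close> moves, so \<open>S' \<le> k\<close>; but
    \<open>le_sum_take\<close> at \<open>Suc k\<close> gives \<open>S' \<ge> Suc k\<close>.\<close>
  have "D \<noteq> []"
  proof
    assume "D = []"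
    with D_Un have "S' = card R" by simp
    also have "\<dots> \<le> k" unfolding R_def by (metis card_image_le card_lessThan finite_lessThan)
    finally show False using le_sum_take[OF Suc.prems] by (simp add: S'_def)
  qed
  have b: "b \<in> set D" "set (deque \<chi> p (Suc k)) = set D - {b}"
    using D_distinct \<open>D \<noteq> []\<close>
    by (simp_all add: b_def removed_ball_def D_def[symmetric] peek_in_set set_pop)
  have R': "removed_ball \<chi> p ` {..<Suc k} = insert b R"
    by (simp add: lessThan_Suc R_def b_def)
  have "distinct (deque \<chi> p (Suc k))"
    using D_distinct by (simp add: D_def[symmetric] distinct_pop)
  moreover have "inj_on (removed_ball \<chi> p) {..<Suc k}"
    using IH(4) b(1) D_Int by (auto simp: lessThan_Suc R_def b_def)
  moreover have "set (deque \<chi> p (Suc k)) \<union> insert b R = {1..S'}"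
    using b D_Un by auto
  moreover have "set (deque \<chi> p (Suc k)) \<inter> insert b R = {}"
    using b D_Int by auto
  ultimately show ?case unfolding R' S'_def by blast
qed

text \<open>In total there are as many balls as moves, so the injectivity from the invariant yields
  surjectivity by counting.\<close>

lemma bij_betw_removed_ball: "bij_betw (removed_ball \<chi> p) {..<length p} {1..length p}"
proof -
  have inj: "inj_on (removed_ball \<chi> p) {..<length p}"
    and sub: "removed_ball \<chi> p ` {..<length p} \<subseteq> {1..length p}"
    using deque_invariant[of "length p" \<chi>] by (auto simp: sum_eq_length)
  have "removed_ball \<chi> p ` {..<length p} = {1..length p}"
    by (rule card_subset_eq) (use sub card_image[OF inj] in auto)
  then show ?thesis using inj by (simp add: bij_betw_def)
qed

lemma sum_take_mono: "j \<le> k \<Longrightarrow> sum_list (take j p) \<le> sum_list (take k p)"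
  by (metis le_add1 le_add_diff_inverse sum_list_append take_add)

text \<open>Batches are intervals between successive partial sums of \<open>p\<close>, and these
  sums are monotone.\<close>

lemma batches_disjoint:
  assumes "i < length p" "j < length p" "i \<noteq> j"
  shows "set (batch p i) \<inter> set (batch p j) = {}"
proof -
  have "set (batch p i) \<inter> set (batch p j) = {}" if "i < j" "j < length p" for i j
    using sum_take_mono[of "Suc i" j] that by (auto simp: set_batch)
  then show ?thesis using assms by (metis Int_commute linorder_neqE_nat)
qed

lemma batches_cover: "k \<le> length p \<Longrightarrow> (\<Union>i<k. set (batch p i)) = {1..sum_list (take k p)}"
proof (induction k)
  case (Suc k)
  then have "(\<Union>i<Suc k. set (batch p i)) =
      {sum_list (take k p)<..sum_list (take (Suc k) p)} \<union> {1..sum_list (take k p)}"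
    by (simp add: lessThan_Suc set_batch)
  also have "\<dots> = {1..sum_list (take (Suc k) p)}"
    using sum_take_mono[of k "Suc k"] by auto
  finally show ?case .
qed simp

text \<open>Up to the shift by \<open>Suc\<close>, each block is the preimage of a batch under the
  bijection \<open>removed_ball\<close>. The nonempty batches partition the labels, so their
  preimages partition the output times.\<close>

lemma partition_on_output_times:
  "partition_on {1..length p} {output_times \<chi> p i | i. i < length p \<and> p ! i > 0}"
proof (rule partition_onI)
  have rem: "removed_ball \<chi> p ` {..<length p} = {1..length p}"
    "inj_on (removed_ball \<chi> p) {..<length p}"
    using bij_betw_removed_ball by (auto simp: bij_betw_def)
  have cover: "(\<Union>i<length p. set (batch p i)) = {1..length p}"
    using batches_cover[of "length p"] by (simp add: sum_eq_length)
  show "\<Union> {output_times \<chi> p i | i. i < length p \<and> p ! i > 0} = {1..length p}"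
  proof (intro equalityI subsetI)
    fix x assume "x \<in> {1..length p}"
    then obtain t where t: "x = Suc t" "t < length p" by (cases x) auto
    then have "removed_ball \<chi> p t \<in> (\<Union>i<length p. set (batch p i))"
      using rem cover by blast
    then obtain i where "i < length p" "removed_ball \<chi> p t \<in> set (batch p i)" by blast
    moreover from this have "p ! i > 0" by (cases "p ! i") (auto simp: batch_def)
    ultimately show "x \<in> \<Union> {output_times \<chi> p i | i. i < length p \<and> p ! i > 0}"
      using t by (auto simp: output_times_def)
  qed (auto simp: output_times_def)
  show "{} \<notin> {output_times \<chi> p i | i. i < length p \<and> p ! i > 0}"
  proof
    assume "{} \<in> {output_times \<chi> p i | i. i < length p \<and> p ! i > 0}"
    then obtain i where i: "output_times \<chi> p i = {}" "i < length p" "p ! i > 0" by force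
    \<comment> \<open>The smallest label of batch \<open>i\<close>, present since
      \<open>p ! i > 0\<close>; its output time lies in the supposedly empty block.\<close>
    let ?b = "Suc (sum_list (take i p))"
    have b: "?b \<in> set (batch p i)" using i by (auto simp: batch_def)
    then have "?b \<in> removed_ball \<chi> p ` {..<length p}" using rem cover i by blast
    then show False using b i(1) by (auto simp: output_times_def)
  qed
  show "disjnt B C" if "B \<in> {output_times \<chi> p i | i. i < length p \<and> p ! i > 0}"
    "C \<in> {output_times \<chi> p i | i. i < length p \<and> p ! i > 0}" "B \<noteq> C" for B C
  proof -
    from that obtain i j where "B = output_times \<chi> p i" "i < length p"
      "C = output_times \<chi> p j" "j < length p" "i \<noteq> j" by auto
    then show ?thesis using batches_disjoint[of i j]
      by (auto simp: output_times_def disjnt_def)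
  qed
qed

end

section \<open>From Lukasiewicz paths to partitions\<close>

lemma length_rise_vector: "path \<in> Luk n \<Longrightarrow> length (rise_vector path) = n"
  by (simp add: Luk_def rise_vector_def)

lemma luk_word_of_path:
  assumes path: "path \<in> Luk n"
  shows "luk_word (map (\<lambda>r. nat (r + 1)) (rise_vector path))" (is "luk_word ?p")
proof -
  have len: "length ?p = n" using length_rise_vector[OF path] by simp
  have steps: "path ! Suc m - path ! m \<in> {1} \<times> {-1..}" if "m < n" for m
    using path that by (auto simp: Luk_def)
  \<comment> \<open>The rises telescope to the height, and each of the \<open>k\<close> entries adds
    1 to its rise.\<close>
  have sum: "int (sum_list (take k ?p)) = snd (path ! k) + int k" if "k \<le> n" for k
    using that
  proof (induction k)
    case 0
    then show ?case using path by (simp add: Luk_def)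
  next
    case (Suc k)
    have "length path = Suc n" using path by (simp add: Luk_def)
    then have "?p ! k = nat (snd (path ! Suc k) - snd (path ! k) + 1)"
      using Suc.prems by (simp add: rise_vector_def)
    \<comment> \<open>This bound makes the truncation by \<open>nat\<close> harmless.\<close>
    moreover have "snd (path ! Suc k) - snd (path ! k) \<ge> -1"
      using steps[of k] Suc.prems by (cases "path ! Suc k"; cases "path ! k") auto
    ultimately have "int (?p ! k) = snd (path ! Suc k) - snd (path ! k) + 1" by simp
    moreover have "sum_list (take (Suc k) ?p) = sum_list (take k ?p) + ?p ! k"
      using Suc.prems len by (subst take_Suc_conv_app_nth) auto
    ultimately show ?case using Suc by simp
  qed
  show ?thesis
  proof
    fix k assume "k \<le> length ?p"
    with len have "k \<le> n" by simp
    with path have "snd (path ! k) \<ge> 0" by (simp add: Luk_def)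
    with sum[OF \<open>k \<le> n\<close>] show "k \<le> sum_list (take k ?p)" by simp
  next
    have "snd (path ! n) = 0" using path by (simp add: Luk_def)
    with sum[of n] len show "sum_list ?p = length ?p" by simp
  qed
qed

lemma output_time_partitions_partition_on:
  assumes "\<pi> \<in> output_time_partitions \<chi>"
  shows "partition_on {1..length \<chi>} \<pi>"
proof -
  from assms obtain path where path: "path \<in> Luk (length \<chi>)"
    and \<pi>: "\<pi> = output_time_partition \<chi> path"
    by (auto simp: output_time_partitions_def)
  show ?thesis
    using luk_word.partition_on_output_times[OF luk_word_of_path[OF path], of \<chi>]
      length_rise_vector[OF path]
    by (simp add: \<pi> output_time_partition_def Let_def)
qed

lemma finite_output_time_partitions: "finite (output_time_partitions \<chi>)"
proof (rule finite_subset)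
  show "output_time_partitions \<chi> \<subseteq> Pow (Pow {1..length \<chi>})"
    using output_time_partitions_partition_on partition_onD1 by fast
qed simp

lemma one_block_in_output_time_partitions:
  assumes "\<chi> \<noteq> []"
  shows "{{1..length \<chi>}} \<in> output_time_partitions \<chi>"
proof -
  define n where "n = length \<chi>"
  \<comment> \<open>The path jumps to height \<open>n - 1\<close> and then descends by 1 at each
    step, so the first move inserts all \<open>n\<close> balls and the later moves insert
    none.\<close>
  define path where "path = map (\<lambda>k. (int k, if k = 0 then 0 else int (n - k))) [0..<Suc n]"
  have "n > 0" using assms by (simp add: n_def)
  have nth: "path ! k = (int k, if k = 0 then 0 else int (n - k))" if "k \<le> n" for k
    unfolding path_def using that by (subst nth_map) (auto simp del: upt_Suc)
  have len: "length path = Suc n" by (simp add: path_def)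
  have path: "path \<in> Luk (length \<chi>)"
    using \<open>n > 0\<close> by (auto simp: Luk_def n_def[symmetric] nth len)
  define p where "p = map (\<lambda>r. nat (r + 1)) (rise_vector path)"
  have "p ! i > 0 \<longleftrightarrow> i = 0" if "i < n" for i
    using that by (auto simp: p_def rise_vector_def len nth of_nat_diff)
  then have "output_time_partition \<chi> path = {output_times \<chi> p 0}"
    using \<open>n > 0\<close> length_rise_vector[OF path]
    by (auto simp: output_time_partition_def Let_def p_def[symmetric] n_def[symmetric])
      (auto simp: p_def n_def)
  \<comment> \<open>The single block of a partition of \<open>{1..n}\<close> must be
    \<open>{1..n}\<close>; the deque need not be simulated.\<close>
  moreover have "partition_on {1..n} (output_time_partition \<chi> path)"
    using output_time_partitions_partition_on path
    by (auto simp: output_time_partitions_def n_def)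
  ultimately have "output_time_partition \<chi> path = {{1..n}}"
    using partition_onD1 by fastforce
  then show ?thesis using path by (auto simp: output_time_partitions_def n_def)
qed

section \<open>Subtuples\<close>

lemma length_subtuple:
  assumes "V \<subseteq> {1..length xs}"
  shows "length (subtuple xs V) = card V"
proof -
  \<comment> \<open>The shift between 0-based list indices and 1-based positions; it reaches all of
    \<open>V\<close> because \<open>0 \<notin> V\<close>.\<close>
  have "Suc ` {i. i < length xs \<and> Suc i \<in> V} = V"
  proof (intro equalityI subsetI)
    fix v assume "v \<in> V"
    with assms show "v \<in> Suc ` {i. i < length xs \<and> Suc i \<in> V}" by (cases v) auto
  qed auto
  then have "card V = card {i. i < length xs \<and> Suc i \<in> V}"
    by (metis card_image inj_Suc)
  then show ?thesis by (simp add: subtuple_def length_nths)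
qed

lemma subtuple_full: "subtuple xs {1..length xs} = xs"
  by (simp add: subtuple_def nths_all)

lemma subtuple_update_notin:
  assumes "Suc i \<notin> V"
  shows "subtuple (xs[i := x]) V = subtuple xs V"
proof (cases "i < length xs")
  case True
  have "subtuple (xs[i := y]) V =
      nths (take i xs) {i. Suc i \<in> V} @ nths (drop (Suc i) xs) {j. Suc (j + Suc i) \<in> V}" for y
    using assms True
    by (simp add: subtuple_def upd_conv_take_nth_drop nths_append nths_Cons min_def)
  \<comment> \<open>The right-hand side is independent of \<open>y\<close>, and writing back
    \<open>xs ! i\<close> leaves \<open>xs\<close> unchanged.\<close>
  from this[of x] this[of "xs ! i"] show ?thesis by simp
qed (simp add: list_update_beyond)

text \<open>The slot \<open>j\<close> is the number of selected positions before \<open>i\<close>.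
  It does not depend on \<open>x\<close>, so linearity in slot \<open>j\<close> of the subtuple
  becomes linearity in slot \<open>i\<close> of the full tuple.\<close>

lemma subtuple_update_in:
  assumes "Suc i \<in> V" "i < length xs"
  shows "\<exists>j < length (subtuple xs V). \<forall>x. subtuple (xs[i := x]) V = (subtuple xs V)[j := x]"
proof -
  let ?I = "{i. Suc i \<in> V}"
  let ?B = "nths (drop (Suc i) xs) {j. j + Suc i \<in> ?I}"
  have split: "subtuple (xs[i := x]) V = nths (take i xs) ?I @ x # ?B" for x
    using assms by (simp add: subtuple_def upd_conv_take_nth_drop nths_append nths_Cons min_def)
  have "subtuple xs V = nths (take i xs) ?I @ (xs ! i) # ?B"
    using split[of "xs ! i"] by simp
  then show ?thesis using split
    by (intro exI[of _ "length (nths (take i xs) ?I)"]) simp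
qed

section \<open>The cumulants\<close>

text \<open>A block equal to the whole set leaves no room for a second nonempty disjoint block,
  which would force the excluded one-block partition. This is what makes recursion on word length
  well-founded.\<close>

lemma block_length_less:
  assumes "\<pi> \<in> output_time_partitions \<chi> - {{{1..length \<chi>}}}" "V \<in> \<pi>"
  shows "V \<subset> {1..length \<chi>}" and "length (subtuple \<chi> V) < length \<chi>"
proof -
  have part: "partition_on {1..length \<chi>} \<pi>"
    using assms output_time_partitions_partition_on by blast
  have sub: "V \<subseteq> {1..length \<chi>}" using part assms(2) partition_onD1 by blast
  have "\<pi> = {{1..length \<chi>}}" if "V = {1..length \<chi>}"
  proof -
    have "W = V" if "W \<in> \<pi>" for W
    proof (rule ccontr)
      assume "W \<noteq> V"
      then have "W \<inter> V = {}"
        using partition_onD2[OF part] \<open>W \<in> \<pi>\<close> assms(2) by (auto simp: disjoint_def)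
      moreover have "W \<subseteq> V" "W \<noteq> {}"
        using part \<open>W \<in> \<pi>\<close> \<open>V = {1..length \<chi>}\<close> by (auto simp: partition_on_def)
      ultimately show False by blast
    qed
    then show ?thesis using assms(2) that by blast
  qed
  then show psub: "V \<subset> {1..length \<chi>}" using sub assms(1) by blast
  show "length (subtuple \<chi> V) < length \<chi>"
    using psubset_card_mono[OF _ psub] sub by (simp add: length_subtuple)
qed

text \<open>Isolates the one-block term, where both subtuples are the full tuples. With
  \<open>\<kappa>\<close> arbitrary, it serves both existence and uniqueness.\<close>

lemma sum_output_time_partitions:
  assumes "\<chi> \<noteq> []" "length as = length \<chi>"
  shows "(\<Sum>\<pi>\<in>output_time_partitions \<chi>. \<Prod>V\<in>\<pi>. \<kappa> (subtuple \<chi> V) (subtuple as V)) =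
    \<kappa> \<chi> as + (\<Sum>\<pi>\<in>output_time_partitions \<chi> - {{{1..length \<chi>}}}.
      \<Prod>V\<in>\<pi>. \<kappa> (subtuple \<chi> V) (subtuple as V))"
  using assms subtuple_full[of \<chi>] subtuple_full[of as]
  by (subst sum.remove[OF finite_output_time_partitions one_block_in_output_time_partitions]) simp_all

text \<open>The moment formula solved for its one-block term. Termination is measured by the word
  \<open>\<chi>\<close> alone, so \<open>as\<close> may have any length here.\<close>

function cumulant :: "('a::monoid_mult \<Rightarrow> complex) \<Rightarrow> side list \<Rightarrow> 'a list \<Rightarrow> complex" where
  "cumulant \<phi> \<chi> as = \<phi> (prod_list as) -
     (\<Sum>\<pi>\<in>output_time_partitions \<chi> - {{{1..length \<chi>}}}.
        \<Prod>V\<in>\<pi>. cumulant \<phi> (subtuple \<chi> V) (subtuple as V))"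
  by pat_completeness auto
termination
  by (relation "measure (\<lambda>(\<phi>, \<chi>, as). length \<chi>)") (use block_length_less in auto)

declare cumulant.simps [simp del]

section \<open>Multilinearity\<close>

lemma linear_prod_one_factor:
  fixes f :: "'i \<Rightarrow> 'a::ring_1 \<Rightarrow> complex"
  assumes "finite I" "i \<in> I" "Vector_Spaces.linear scale (*) (f i)"
    and "\<And>j x y. j \<in> I \<Longrightarrow> j \<noteq> i \<Longrightarrow> f j x = f j y"
  shows "Vector_Spaces.linear scale (*) (\<lambda>x. \<Prod>j\<in>I. f j x)"
proof -
  \<comment> \<open>The other factors are constant in \<open>x\<close>; evaluating them at 0 exposes
    the product as a fixed scalar times \<open>f i x\<close>.\<close>
  have "(\<Prod>j\<in>I - {i}. f j x) = (\<Prod>j\<in>I - {i}. f j 0)" for x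
    by (rule prod.cong) (use assms(4) in auto)
  then have "(\<Prod>j\<in>I. f j x) = f i x * (\<Prod>j\<in>I - {i}. f j 0)" for x
    using prod.remove[OF assms(1,2), of "\<lambda>j. f j x"] by simp
  then show ?thesis using assms(3) by (simp add: Vector_Spaces.linear_iff algebra_simps)
qed

context nc_prob_space
begin

lemma linear_prod_list:
  assumes "i < length xs"
  shows "Vector_Spaces.linear scale (*) (\<lambda>x. \<phi> (prod_list (xs[i := x])))"
proof -
  have eq: "prod_list (xs[i := x]) = prod_list (take i xs) * x * prod_list (drop (Suc i) xs)" for x
    using assms by (simp add: upd_conv_take_nth_drop mult.assoc)
  have "Vector_Spaces.linear scale (*) \<phi>" by unfold_locales
  then show ?thesis
    by (simp add: Vector_Spaces.linear_iff eq distrib_left distrib_right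
        scale_mult_left scale_mult_right)
qed

lemma linear_cumulant:
  assumes "length xs = length \<chi>" "i < length \<chi>"
  shows "Vector_Spaces.linear scale (*) (\<lambda>x. cumulant \<phi> \<chi> (xs[i := x]))"
  using assms
proof (induction "length \<chi>" arbitrary: \<chi> xs i rule: less_induct)
  case less
  have "Vector_Spaces.linear scale (*)
      (\<lambda>x. \<Prod>V\<in>\<pi>. cumulant \<phi> (subtuple \<chi> V) (subtuple (xs[i := x]) V))"
    if \<pi>: "\<pi> \<in> output_time_partitions \<chi> - {{{1..length \<chi>}}}" for \<pi>
  proof -
    have part: "partition_on {1..length \<chi>} \<pi>"
      using \<pi> output_time_partitions_partition_on by blast
    have "Suc i \<in> \<Union>\<pi>" using partition_onD1[OF part] less.prems by auto
    \<comment> \<open>List index \<open>i\<close> is position \<open>Suc i\<close>. Only the factor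
      of this block varies with \<open>x\<close>, and the induction hypothesis makes it
      linear.\<close>
    then obtain V where V: "V \<in> \<pi>" "Suc i \<in> V" by blast
    have "V \<subseteq> {1..length \<chi>}" using block_length_less(1)[OF \<pi> V(1)] by blast
    then have len: "length (subtuple xs V) = length (subtuple \<chi> V)"
      using less.prems(1) by (simp add: length_subtuple)
    obtain j where j: "j < length (subtuple xs V)"
      "\<And>x. subtuple (xs[i := x]) V = (subtuple xs V)[j := x]"
      using subtuple_update_in[OF V(2)] less.prems by metis
    show ?thesis
    proof (rule linear_prod_one_factor)
      show "finite \<pi>" using finite_elements[OF _ part] by simp
      show "V \<in> \<pi>" by fact
      show "Vector_Spaces.linear scale (*)
          (\<lambda>x. cumulant \<phi> (subtuple \<chi> V) (subtuple (xs[i := x]) V))"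
        unfolding j(2)
        using less.hyps[OF block_length_less(2)[OF \<pi> V(1)] len] j(1) len by simp
      fix W x y assume "W \<in> \<pi>" "W \<noteq> V"
      then have "Suc i \<notin> W"
        using partition_onD2[OF part] V by (auto simp: disjoint_def)
      then show "cumulant \<phi> (subtuple \<chi> W) (subtuple (xs[i := x]) W) =
          cumulant \<phi> (subtuple \<chi> W) (subtuple (xs[i := y]) W)"
        by (simp add: subtuple_update_notin)
    qed
  qed
  then show ?case
    using linear_prod_list[of i xs] less.prems
    by (subst cumulant.simps)
      (simp add: Vector_Spaces.linear_iff algebra_simps sum.distrib sum_distrib_left)
qed

end

section \<open>Uniqueness and existence\<close>

lemma cumulant_unique:
  fixes \<kappa> :: "side list \<Rightarrow> 'a::monoid_mult list \<Rightarrow> complex"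
  assumes moment: "\<And>\<chi> as. \<chi> \<noteq> [] \<Longrightarrow> length as = length \<chi> \<Longrightarrow> \<phi> (prod_list as) =
      (\<Sum>\<pi>\<in>output_time_partitions \<chi>. \<Prod>V\<in>\<pi>. \<kappa> (subtuple \<chi> V) (subtuple as V))"
    and "\<chi> \<noteq> []" "length as = length \<chi>"
  shows "\<kappa> \<chi> as = cumulant \<phi> \<chi> as"
  using assms(2,3)
proof (induction "length \<chi>" arbitrary: \<chi> as rule: less_induct)
  case less
  \<comment> \<open>Agreement on the shorter words of proper blocks makes the remainders of both
    moment formulas equal, hence also the one-block terms.\<close>
  have "\<kappa> (subtuple \<chi> V) (subtuple as V) = cumulant \<phi> (subtuple \<chi> V) (subtuple as V)"
    if \<pi>: "\<pi> \<in> output_time_partitions \<chi> - {{{1..length \<chi>}}}" "V \<in> \<pi>" for \<pi> V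
  proof (rule less.hyps)
    have part: "partition_on {1..length \<chi>} \<pi>"
      using \<pi> output_time_partitions_partition_on by blast
    have sub: "V \<subseteq> {1..length \<chi>}" "finite V"
      using block_length_less(1)[OF \<pi>] finite_subset[of V "{1..length \<chi>}"] by auto
    then show "length (subtuple as V) = length (subtuple \<chi> V)"
      using less.prems by (simp add: length_subtuple)
    \<comment> \<open>The induction hypothesis covers nonempty words only, so blocks must be
      nonempty.\<close>
    have "V \<noteq> {}" using part \<pi>(2) by (auto simp: partition_on_def)
    then have "length (subtuple \<chi> V) > 0" using sub by (simp add: length_subtuple card_gt_0_iff)
    then show "subtuple \<chi> V \<noteq> []" by blast
  qed (rule block_length_less[OF \<pi>])
  then have "(\<Sum>\<pi>\<in>output_time_partitions \<chi> - {{{1..length \<chi>}}}.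
        \<Prod>V\<in>\<pi>. \<kappa> (subtuple \<chi> V) (subtuple as V)) =
      (\<Sum>\<pi>\<in>output_time_partitions \<chi> - {{{1..length \<chi>}}}.
        \<Prod>V\<in>\<pi>. cumulant \<phi> (subtuple \<chi> V) (subtuple as V))"
    by (intro sum.cong prod.cong refl)
  then show ?case
    using moment[OF less.prems] sum_output_time_partitions[OF less.prems, of \<kappa>]
    by (subst cumulant.simps) simp
qed

theorem mainTheorem3:
  fixes scale :: "complex \<Rightarrow> 'a::ring_1 \<Rightarrow> 'a" and \<phi> :: "'a \<Rightarrow> complex"
  assumes "nc_prob_space scale \<phi>"
  shows "\<exists>!\<kappa>. \<kappa> \<in> (\<Pi>\<^sub>E \<chi>\<in>{\<chi> :: side list. length \<chi> \<ge> 1}.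
                     multilinear_functionals scale (length \<chi>)) \<and>
              (\<forall>n\<ge>1. \<forall>\<chi> :: side list. \<forall>as :: 'a list. length \<chi> = n \<longrightarrow> length as = n \<longrightarrow>
                 \<phi> (prod_list as) =
                   (\<Sum>\<pi>\<in>output_time_partitions \<chi>.
                      \<Prod>V\<in>\<pi>. \<kappa> (subtuple \<chi> V) (subtuple as V)))"
proof (rule ex1I, intro conjI)
  interpret nc_prob_space scale \<phi> by fact
  \<comment> \<open>Both restrictions set values outside the intended domain to
    \<open>undefined\<close>, as the extensional function spaces demand.\<close>
  define K where "K = (\<lambda>\<chi>\<in>{\<chi> :: side list. length \<chi> \<ge> 1}.
      \<lambda>as\<in>{as. length as = length \<chi>}. cumulant \<phi> \<chi> as)"
  have K: "K \<chi> as = cumulant \<phi> \<chi> as" if "\<chi> \<noteq> []" "length as = length \<chi>" for \<chi> as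
    using that by (cases \<chi>) (auto simp: K_def)
  show "K \<in> (\<Pi>\<^sub>E \<chi>\<in>{\<chi> :: side list. length \<chi> \<ge> 1}. multilinear_functionals scale (length \<chi>))"
    using linear_cumulant by (auto simp: K_def multilinear_functionals_def)
  show "\<forall>n\<ge>1. \<forall>\<chi> :: side list. \<forall>as :: 'a list. length \<chi> = n \<longrightarrow> length as = n \<longrightarrow>
      \<phi> (prod_list as) =
        (\<Sum>\<pi>\<in>output_time_partitions \<chi>. \<Prod>V\<in>\<pi>. K (subtuple \<chi> V) (subtuple as V))"
  proof (intro allI impI)
    fix n :: nat and \<chi> :: "side list" and as :: "'a list"
    assume n: "n \<ge> 1" "length \<chi> = n" "length as = n"
    then have ne: "\<chi> \<noteq> []" by auto
    have "(\<Sum>\<pi>\<in>output_time_partitions \<chi>. \<Prod>V\<in>\<pi>. K (subtuple \<chi> V) (subtuple as V)) =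
        (\<Sum>\<pi>\<in>output_time_partitions \<chi>. \<Prod>V\<in>\<pi>. cumulant \<phi> (subtuple \<chi> V) (subtuple as V))"
    \<comment> \<open>\<open>K\<close> agrees with \<open>cumulant\<close> only on nonempty words
      with arguments of matching length, which has to be checked for every block.\<close>
    proof (intro sum.cong prod.cong refl K)
      fix \<pi> V assume \<pi>: "\<pi> \<in> output_time_partitions \<chi>" "V \<in> \<pi>"
      have part: "partition_on {1..length \<chi>} \<pi>"
        using \<pi> output_time_partitions_partition_on by blast
      have sub: "V \<subseteq> {1..length \<chi>}" using partition_onD1[OF part] \<pi>(2) by blast
      then have fin: "finite V" by (rule finite_subset) simp
      show "length (subtuple as V) = length (subtuple \<chi> V)"
        using n sub by (simp add: length_subtuple)
      have "V \<noteq> {}" using part \<pi>(2) by (auto simp: partition_on_def)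
      then have "length (subtuple \<chi> V) > 0"
        using sub fin by (simp add: length_subtuple card_gt_0_iff)
      then show "subtuple \<chi> V \<noteq> []" by blast
    qed
    also have "\<dots> = \<phi> (prod_list as)"
      \<comment> \<open>Unfolding the one-block term once cancels the remaining sum.\<close>
      using sum_output_time_partitions[OF ne, of as "cumulant \<phi>"] n
      by (simp add: cumulant.simps[of \<phi> \<chi> as])
    finally show "\<phi> (prod_list as) =
        (\<Sum>\<pi>\<in>output_time_partitions \<chi>. \<Prod>V\<in>\<pi>. K (subtuple \<chi> V) (subtuple as V))" ..
  qed
  fix \<kappa> assume \<kappa>: "\<kappa> \<in> (\<Pi>\<^sub>E \<chi>\<in>{\<chi> :: side list. length \<chi> \<ge> 1}.
                     multilinear_functionals scale (length \<chi>)) \<and>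
              (\<forall>n\<ge>1. \<forall>\<chi> :: side list. \<forall>as :: 'a list. length \<chi> = n \<longrightarrow> length as = n \<longrightarrow>
                 \<phi> (prod_list as) =
                   (\<Sum>\<pi>\<in>output_time_partitions \<chi>.
                      \<Prod>V\<in>\<pi>. \<kappa> (subtuple \<chi> V) (subtuple as V)))"
  have moment: "\<phi> (prod_list as) =
      (\<Sum>\<pi>\<in>output_time_partitions \<chi>. \<Prod>V\<in>\<pi>. \<kappa> (subtuple \<chi> V) (subtuple as V))"
    if "\<chi> \<noteq> []" "length as = length \<chi>" for \<chi> :: "side list" and as :: "'a list"
    using \<kappa> that by (auto simp: Suc_le_eq)
  show "\<kappa> = K"
  proof (intro ext)
    fix \<chi> :: "side list" and as :: "'a list"
    show "\<kappa> \<chi> as = K \<chi> as"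
    proof (cases "\<chi> = []")
      case True
      \<comment> \<open>The empty word is outside the index set, so both families take the default
        value \<open>undefined\<close> there.\<close>
      then show ?thesis using \<kappa> by (auto simp: K_def PiE_def extensional_def)
    next
      case False
      show ?thesis
      proof (cases "length as = length \<chi>")
        case True
        then show ?thesis using cumulant_unique[of \<phi> \<kappa>, OF moment] K False by simp
      next
        case len: False
        \<comment> \<open>For arguments of the wrong length, extensionality of each functional fixes
          the value.\<close>
        have "\<kappa> \<chi> \<in> multilinear_functionals scale (length \<chi>)"
          using \<kappa> False by (auto simp: Suc_le_eq dest!: PiE_mem)
        then have "\<kappa> \<chi> as = undefined"
          using len by (auto simp: multilinear_functionals_def extensional_def)
        then show ?thesis using len False by (auto simp: K_def Suc_le_eq)
      qed
    qed
  qed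
qed

end
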